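(* Let $1\le n_0\le n$ be integers. Let $\mathcal F_{n_0,n}$ be the set of all families $\{A_{u,v},r_{u,v},d_{u,v},\delta_{u,v}^w\}_{u,v,w\in[n]}$ with $A_{u,v},r_{u,v},\delta_{u,v}^w\in\{0,1\}$ and $d_{u,v}\in\{0,1,\dots,n\}$ that satisfy the constraint system (E) with parameters $n_0,n$ given in the context. Let $\mathcal G_{n_0,n}$ be the set of all labeled directed graphs whose number of nodes $m$ satisfies $n_0\le m\le n$, the node set of a graph with $m$ nodes being $\{0,1,\dots,m-1\}$. Then there is a bijection between $\mathcal F_{n_0,n}$ and $\mathcal G_{n_0,n}$.
   Context: Notation: $[n]=\{0,1,\dots,n-1\}$. Graphs are directed, without self-loops or multiple edges. The variable $A_{v,v}$ encodes whether node $v$ exists, and $A_{u,v}$ ($u\ne v$) whether the edge $u\to v$ exists. Constraint system (E) with parameters $n_0,n$. Unless otherwise indicated, each constraint is imposed for all pairwise distinct $u,v,w\in[n]$ (for those indices among $u,v,w$ that occur in it): 1. $\sum_{v\in[n]}A_{v,v}\ge n_0$, and $A_{v,v}\ge A_{v+1,v+1}$ for all $v\in[n-1]$; 2. $2 r_{u,v}\le A_{u,u}+A_{v,v}$, $\; d_{u,v}\ge n(1-A_{u,u})$, $\; d_{u,v}\ge n(1-A_{v,v})$; 3. $r_{v,v}=1$, $d_{v,v}=0$, $\delta_{v,v}^v=1$, and $\delta_{v,v}^w=0$ for $w\neq v$; 4. $r_{u,v}\ge A_{u,v}$, $\; 2-A_{u,v}\le d_{u,v}\le 1+(n-1)(1-A_{u,v})$;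 5. $r_{u,v}\le n-d_{u,v}\le (n-1) r_{u,v}$; 6. $2\delta_{u,v}^w\le r_{u,w}+r_{w,v}\le 1+r_{u,v}$; 7. $\delta_{u,v}^u=\delta_{u,v}^v=1$, $\; 2+r_{u,v}-A_{u,v}\le \sum_{w\in[n]}\delta_{u,v}^w\le 2+(n-2)(r_{u,v}-A_{u,v})$ (the sum is over all $w\in[n]$, including $u$ and $v$); 8. $(1-\delta_{u,v}^w)-(n+1)(2-r_{u,w}-r_{w,v})\le d_{u,w}+d_{w,v}-d_{u,v}\le 2n(1-\delta_{u,v}^w)$. *)

theory Defs
  imports "Graph_Theory.Pair_Digraph"
begin

text \<open>
  The index set \<open>[n]\<close> is \<open>{..<n}\<close>. The argument order in \<open>\<delta> u v w\<close> corresponds to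
  \<open>\<delta>\<^sub>u\<^sub>,\<^sub>v\<close> with superscript \<open>w\<close>. All variables take values in \<open>int\<close>, so that the
  subtractions below are not truncated.
\<close>

definition constraints ::
    "nat \<Rightarrow> nat \<Rightarrow> (nat \<Rightarrow> nat \<Rightarrow> int) \<Rightarrow> (nat \<Rightarrow> nat \<Rightarrow> int) \<Rightarrow> (nat \<Rightarrow> nat \<Rightarrow> int) \<Rightarrow>
     (nat \<Rightarrow> nat \<Rightarrow> nat \<Rightarrow> int) \<Rightarrow> bool"
  where
  "constraints n\<^sub>0 n A r d \<delta> \<longleftrightarrow>
    (\<Sum>v<n. A v v) \<ge> int n\<^sub>0 \<and>
    (\<forall>v<n - 1. A v v \<ge> A (v + 1) (v + 1)) \<and>

    (\<forall>u<n. \<forall>v<n. u \<noteq> v \<longrightarrow>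
       2 * r u v \<le> A u u + A v v \<and>
       d u v \<ge> int n * (1 - A u u) \<and>
       d u v \<ge> int n * (1 - A v v)) \<and>

    (\<forall>v<n. r v v = 1 \<and> d v v = 0 \<and> \<delta> v v v = 1) \<and>
    (\<forall>v<n. \<forall>w<n. w \<noteq> v \<longrightarrow> \<delta> v v w = 0) \<and>

    (\<forall>u<n. \<forall>v<n. u \<noteq> v \<longrightarrow>
       r u v \<ge> A u v \<and>
       2 - A u v \<le> d u v \<and>
       d u v \<le> 1 + (int n - 1) * (1 - A u v)) \<and>

    (\<forall>u<n. \<forall>v<n. u \<noteq> v \<longrightarrow>
       r u v \<le> int n - d u v \<and>
       int n - d u v \<le> (int n - 1) * r u v) \<and>

    (\<forall>u<n. \<forall>v<n. \<forall>w<n. u \<noteq> v \<and> u \<noteq> w \<and> v \<noteq> w \<longrightarrow>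
       2 * \<delta> u v w \<le> r u w + r w v \<and>
       r u w + r w v \<le> 1 + r u v) \<and>

    (\<forall>u<n. \<forall>v<n. u \<noteq> v \<longrightarrow>
       \<delta> u v u = 1 \<and> \<delta> u v v = 1 \<and>
       2 + r u v - A u v \<le> (\<Sum>w<n. \<delta> u v w) \<and>
       (\<Sum>w<n. \<delta> u v w) \<le> 2 + (int n - 2) * (r u v - A u v)) \<and>

    (\<forall>u<n. \<forall>v<n. \<forall>w<n. u \<noteq> v \<and> u \<noteq> w \<and> v \<noteq> w \<longrightarrow>
       (1 - \<delta> u v w) - (int n + 1) * (2 - r u w - r w v) \<le> d u w + d w v - d u v \<and>
       d u w + d w v - d u v \<le> 2 * int n * (1 - \<delta> u v w))"

text \<open>
  Families indexed by \<open>[n]\<close> are extensional functions (\<open>\<rightarrow>\<^sub>E\<close>), so that two families that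
  agree on all indices in \<open>[n]\<close> are equal.
\<close>

definition feasible_families ::
    "nat \<Rightarrow> nat \<Rightarrow>
     ((nat \<Rightarrow> nat \<Rightarrow> int) \<times> (nat \<Rightarrow> nat \<Rightarrow> int) \<times> (nat \<Rightarrow> nat \<Rightarrow> int) \<times>
      (nat \<Rightarrow> nat \<Rightarrow> nat \<Rightarrow> int)) set"
  where
  "feasible_families n\<^sub>0 n =
    {(A, r, d, \<delta>).
       A \<in> {..<n} \<rightarrow>\<^sub>E {..<n} \<rightarrow>\<^sub>E {0, 1} \<and>
       r \<in> {..<n} \<rightarrow>\<^sub>E {..<n} \<rightarrow>\<^sub>E {0, 1} \<and>
       d \<in> {..<n} \<rightarrow>\<^sub>E {..<n} \<rightarrow>\<^sub>E {0..int n} \<and>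
       \<delta> \<in> {..<n} \<rightarrow>\<^sub>E {..<n} \<rightarrow>\<^sub>E {..<n} \<rightarrow>\<^sub>E {0, 1} \<and>
       constraints n\<^sub>0 n A r d \<delta>}"

text \<open>
  The locale \<open>pair_digraph\<close> describes finite digraphs without self-loops; since arcs are pairs
  of nodes, there are no multiple arcs. Graphs are compared by equality, not up to isomorphism.
\<close>

definition labeled_digraphs :: "nat \<Rightarrow> nat \<Rightarrow> nat pair_pre_digraph set" where
  "labeled_digraphs n\<^sub>0 n =
    {G. pair_digraph G \<and> (\<exists>m. n\<^sub>0 \<le> m \<and> m \<le> n \<and> pverts G = {..<m})}"

end

theory Submission
  imports Defs
begin

text \<open>
  The bijection reads off the graph from \<open>A\<close>: its nodes are the \<open>v\<close> with \<open>A v v = 1\<close>, which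
  form an initial segment of \<open>[n]\<close>, and its arcs are the pairs of distinct nodes with
  \<open>A u v = 1\<close>. That this is a bijection means that \<open>A\<close> determines \<open>r\<close>, \<open>d\<close>, \<open>\<delta>\<close>, and that
  a feasible choice of them exists for every graph.

  The intended solution is that \<open>r\<close> is reachability, \<open>d\<close> is the length of a shortest walk, or
  \<open>n\<close> if there is none, and \<open>\<delta> u v w = 1\<close> means that \<open>w\<close> lies on a shortest walk from \<open>u\<close>
  to \<open>v\<close>. It is feasible (\<open>feasible_family_exists\<close>) essentially because distances satisfy the
  triangle inequality, because a distance in a graph with at most \<open>n\<close> nodes is less than \<open>n\<close>
  (\<open>rel_dist_less_card\<close>), so that \<open>n\<close> is free to encode unreachability, and because a shortest
  walk that is not a single arc has an interior node.

  Uniqueness (\<open>feasible_family_unique\<close>) needs no walks at all. In any feasible family, an arc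
  forces \<open>r u v = 1\<close> and \<open>d u v = 1\<close>; the relation \<open>r\<close> is transitive and \<open>d\<close> satisfies the
  triangle inequality along it; and if \<open>r u v = 1\<close> without an arc, then some \<open>w\<close> splits
  \<open>d u v\<close> into two smaller positive distances. Hence, if two feasible families share \<open>A\<close>,
  induction on the first distance transports reachability to the second family without
  increasing the distance (\<open>reach_dist_le\<close>). By symmetry \<open>r\<close> and \<open>d\<close> agree, and they
  determine \<open>\<delta>\<close> (\<open>\<delta>_iff_between\<close>).
\<close>

section \<open>Distances in a relation\<close>

definition rel_dist :: "('a \<times> 'a) set \<Rightarrow> 'a \<Rightarrow> 'a \<Rightarrow> nat" where
  "rel_dist E u v = (LEAST k. (u, v) \<in> E ^^ k)"

lemma rel_dist_le: "(u, v) \<in> E ^^ k \<Longrightarrow> rel_dist E u v \<le> k"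
  unfolding rel_dist_def by (rule Least_le)

lemma relpow_rel_dist:
  assumes "(u, v) \<in> E\<^sup>*"
  shows "(u, v) \<in> E ^^ rel_dist E u v"
proof -
  obtain k where "(u, v) \<in> E ^^ k"
    using assms rtrancl_imp_relpow by blast
  then show ?thesis
    unfolding rel_dist_def by (rule LeastI)
qed

lemma rel_dist_refl: "rel_dist E u u = 0"
  using rel_dist_le[of u u 0 E] by simp

lemma rel_dist_eq_0: "(u, v) \<in> E\<^sup>* \<Longrightarrow> rel_dist E u v = 0 \<Longrightarrow> u = v"
  using relpow_rel_dist[of u v E] by simp

lemma rel_dist_triangle:
  assumes "(u, w) \<in> E\<^sup>*" "(w, v) \<in> E\<^sup>*"
  shows "rel_dist E u v \<le> rel_dist E u w + rel_dist E w v"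
  using assms by (intro rel_dist_le) (auto simp: relpow_add dest!: relpow_rel_dist)

lemma rel_dist_arc:
  assumes "(u, v) \<in> E" "u \<noteq> v"
  shows "rel_dist E u v = 1"
proof -
  have "rel_dist E u v \<le> 1"
    using assms by (intro rel_dist_le) simp
  moreover have "rel_dist E u v \<noteq> 0"
    using assms rel_dist_eq_0 by (metis r_into_rtrancl)
  ultimately show ?thesis by simp
qed

lemma rel_dist_non_arc:
  assumes "(u, v) \<in> E\<^sup>*" "(u, v) \<notin> E" "u \<noteq> v"
  shows "2 \<le> rel_dist E u v"
proof -
  have "rel_dist E u v \<noteq> 0"
    using assms rel_dist_eq_0 by metis
  moreover have "rel_dist E u v \<noteq> 1"
    using assms(2) relpow_rel_dist[OF assms(1)] by auto
  ultimately show ?thesis by simp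
qed

lemma rel_dist_penultimate:
  assumes "(u, v) \<in> E\<^sup>*" "rel_dist E u v = Suc k"
  obtains w where "(u, w) \<in> E\<^sup>*" "(w, v) \<in> E" "rel_dist E u w = k"
proof -
  obtain w where w: "(u, w) \<in> E ^^ k" "(w, v) \<in> E"
    using relpow_rel_dist[OF assms(1)] assms(2) by auto
  have uw: "(u, w) \<in> E\<^sup>*"
    using w(1) by (rule relpow_imp_rtrancl)
  have "rel_dist E u v \<le> Suc (rel_dist E u w)"
    using relpow_rel_dist[OF uw] w(2) by (intro rel_dist_le) auto
  with assms(2) rel_dist_le[OF w(1)] have "rel_dist E u w = k" by simp
  with uw w(2) show thesis by (rule that)
qed

text \<open>
  Going back along a shortest walk, every number up to the distance of \<open>v\<close> occurs as the
  distance of some node of \<open>V\<close>, so \<open>V\<close> must have more than that many nodes.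
\<close>

lemma rel_dist_less_card:
  assumes fin: "finite V" and E: "E \<subseteq> V \<times> V" and u: "u \<in> V" and uv: "(u, v) \<in> E\<^sup>*"
  shows "rel_dist E u v < card V"
proof -
  have "{..k} \<subseteq> rel_dist E u ` V" if "(u, x) \<in> E\<^sup>*" "rel_dist E u x = k" for k x
    using that
  proof (induction k arbitrary: x)
    case 0
    then show ?case using u rel_dist_refl[of E u] by force
  next
    case (Suc k)
    obtain w where w: "(u, w) \<in> E\<^sup>*" "(w, x) \<in> E" "rel_dist E u w = k"
      using rel_dist_penultimate[OF Suc.prems] .
    have "{..k} \<subseteq> rel_dist E u ` V"
      using Suc.IH[OF w(1,3)] .
    moreover have "Suc k \<in> rel_dist E u ` V"
      using w(2) E Suc.prems(2) by force
    ultimately show ?case by (simp add: atMost_Suc)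
  qed
  from this[OF uv refl] have "card {..rel_dist E u v} \<le> card (rel_dist E u ` V)"
    using fin by (intro card_mono) auto
  also have "\<dots> \<le> card V"
    using fin by (rule card_image_le)
  finally show ?thesis by simp
qed


section \<open>What the constraints say\<close>

lemma sum_split_two:
  fixes f :: "nat \<Rightarrow> 'a :: comm_monoid_add"
  assumes "u < n" "v < n" "u \<noteq> v"
  shows "(\<Sum>w<n. f w) = f u + (f v + (\<Sum>w\<in>{..<n} - {u, v}. f w))"
proof -
  have "{..<n} - {u, v} = {..<n} - {u} - {v}" by auto
  then show ?thesis
    using assms by (simp add: sum.remove[of "{..<n}" u] sum.remove[of "{..<n} - {u}" v])
qed

lemma PiE_PiE_ext:
  assumes f: "f \<in> I \<rightarrow>\<^sub>E (J \<rightarrow>\<^sub>E S)" and g: "g \<in> I \<rightarrow>\<^sub>E (J \<rightarrow>\<^sub>E S)"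
    and eq: "\<And>i j. i \<in> I \<Longrightarrow> j \<in> J \<Longrightarrow> f i j = g i j"
  shows "f = g"
  using f g
proof (rule PiE_ext)
  fix i assume i: "i \<in> I"
  show "f i = g i"
    by (rule PiE_ext[OF PiE_mem[OF f i] PiE_mem[OF g i] eq[OF i]])
qed

locale feasible_family =
  fixes n\<^sub>0 n :: nat and A r d :: "nat \<Rightarrow> nat \<Rightarrow> int" and \<delta> :: "nat \<Rightarrow> nat \<Rightarrow> nat \<Rightarrow> int"
  assumes feasible: "(A, r, d, \<delta>) \<in> feasible_families n\<^sub>0 n"
begin

lemma constr: "constraints n\<^sub>0 n A r d \<delta>"
  using feasible by (simp add: feasible_families_def)

text \<open>The conjuncts of \<open>constraints\<close>, one by one, in the form of rules.\<close>

lemmas constr_from_1 = constr[unfolded constraints_def]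
lemmas constr_from_2 = constr_from_1[THEN conjunct2]
lemmas constr_from_3 = constr_from_2[THEN conjunct2]
lemmas constr_from_4 = constr_from_3[THEN conjunct2]
lemmas constr_from_5 = constr_from_4[THEN conjunct2]
lemmas constr_from_6 = constr_from_5[THEN conjunct2]
lemmas constr_from_7 = constr_from_6[THEN conjunct2]
lemmas constr_from_8 = constr_from_7[THEN conjunct2]
lemmas constr_from_9 = constr_from_8[THEN conjunct2]
lemmas constr_from_10 = constr_from_9[THEN conjunct2]

lemmas node_count = constr_from_1[THEN conjunct1]
lemmas node_decreasing = constr_from_2[THEN conjunct1, rule_format]
lemmas node_bounds = constr_from_3[THEN conjunct1, rule_format]
lemmas diagonal_values = constr_from_4[THEN conjunct1, rule_format]
lemmas diagonal_between = constr_from_5[THEN conjunct1, rule_format]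
lemmas arc_bounds = constr_from_6[THEN conjunct1, rule_format]
lemmas reach_dist_bounds = constr_from_7[THEN conjunct1, rule_format]
lemmas reach_bounds = constr_from_8[THEN conjunct1, rule_format]
lemmas between_count = constr_from_9[THEN conjunct1, rule_format]
lemmas between_dist = constr_from_10[rule_format]

lemma extensional:
  "A \<in> {..<n} \<rightarrow>\<^sub>E {..<n} \<rightarrow>\<^sub>E {0, 1}"
  "r \<in> {..<n} \<rightarrow>\<^sub>E {..<n} \<rightarrow>\<^sub>E {0, 1}"
  "d \<in> {..<n} \<rightarrow>\<^sub>E {..<n} \<rightarrow>\<^sub>E {0..int n}"
  "\<delta> \<in> {..<n} \<rightarrow>\<^sub>E {..<n} \<rightarrow>\<^sub>E {..<n} \<rightarrow>\<^sub>E {0, 1}"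
  using feasible by (simp_all add: feasible_families_def)

lemma A_binary: "u < n \<Longrightarrow> v < n \<Longrightarrow> A u v = 0 \<or> A u v = 1"
  using extensional(1) by (fastforce dest!: PiE_mem)

lemma r_binary: "u < n \<Longrightarrow> v < n \<Longrightarrow> r u v = 0 \<or> r u v = 1"
  using extensional(2) by (fastforce dest!: PiE_mem)

lemma \<delta>_binary: "u < n \<Longrightarrow> v < n \<Longrightarrow> w < n \<Longrightarrow> \<delta> u v w = 0 \<or> \<delta> u v w = 1"
  using extensional(4) by (fastforce dest!: PiE_mem)

lemma diagonal: "v < n \<Longrightarrow> r v v = 1" "v < n \<Longrightarrow> d v v = 0"
  "v < n \<Longrightarrow> w < n \<Longrightarrow> \<delta> v v w = of_bool (w = v)"
  using diagonal_values[of v] diagonal_between[of v w] by auto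

lemma \<delta>_ends: "u < n \<Longrightarrow> v < n \<Longrightarrow> u \<noteq> v \<Longrightarrow> \<delta> u v u = 1 \<and> \<delta> u v v = 1"
  using between_count[of u v] by simp

lemma arc:
  assumes "u < n" "v < n" "u \<noteq> v" "A u v = 1"
  shows "r u v = 1" "d u v = 1" "A u u = 1" "A v v = 1"
proof -
  have "r u v \<ge> A u v" "2 - A u v \<le> d u v" "d u v \<le> 1 + (int n - 1) * (1 - A u v)"
    "2 * r u v \<le> A u u + A v v"
    using arc_bounds[OF assms(1-3)] node_bounds[OF assms(1-3)] by auto
  with assms r_binary[of u v] A_binary[of u u] A_binary[of v v]
  show "r u v = 1" "d u v = 1" "A u u = 1" "A v v = 1" by auto
qed

lemma dist_unreachable:
  assumes "u < n" "v < n" "u \<noteq> v" "r u v = 0"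
  shows "d u v = int n"
proof -
  have "r u v \<le> int n - d u v" "int n - d u v \<le> (int n - 1) * r u v"
    using reach_dist_bounds[OF assms(1-3)] by auto
  with assms(4) show ?thesis by simp
qed

lemma dist_pos:
  assumes "u < n" "v < n" "u \<noteq> v"
  shows "1 \<le> d u v"
proof -
  have "2 - A u v \<le> d u v"
    using arc_bounds[OF assms] by simp
  with A_binary[of u v] assms show ?thesis by auto
qed

text \<open>
  When \<open>r u w = r w v = 1\<close>, the big-\<open>M\<close> term with factor \<open>n + 1\<close> vanishes and the lower bound
  on \<open>d u w + d w v - d u v\<close> becomes the triangle inequality.
\<close>

lemma reach_trans:
  assumes "u < n" "v < n" "w < n" "r u w = 1" "r w v = 1"
  shows "r u v = 1" "d u v \<le> d u w + d w v"
proof -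
  have "r u v = 1 \<and> d u v \<le> d u w + d w v"
  proof (cases "u \<noteq> v \<and> u \<noteq> w \<and> v \<noteq> w")
    case True
    then have "r u w + r w v \<le> 1 + r u v"
      "(1 - \<delta> u v w) - (int n + 1) * (2 - r u w - r w v) \<le> d u w + d w v - d u v"
      using reach_bounds[OF assms(1-3)] between_dist[OF assms(1-3)] by auto
    with assms r_binary[of u v] \<delta>_binary[of u v w] show ?thesis by auto
  next
    case False
    have "0 \<le> d u w + d w v"
      using dist_pos[of u w] dist_pos[of w v] diagonal(2) assms(1-3)
      by (cases "u = w"; cases "w = v") force+
    with False assms diagonal show ?thesis by auto
  qed
  then show "r u v = 1" "d u v \<le> d u w + d w v" by auto
qed

text \<open>
  If \<open>\<delta> u v w = 1\<close>, then \<open>r u w = r w v = 1\<close>, both big-\<open>M\<close> terms vanish, and the two bounds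
  force equality. If \<open>r u w = r w v = 1\<close> but \<open>\<delta> u v w = 0\<close>, the lower bound makes the
  triangle inequality strict.
\<close>

lemma \<delta>_iff_between:
  assumes "u < n" "v < n" "w < n" "u \<noteq> v" "u \<noteq> w" "v \<noteq> w"
  shows "\<delta> u v w = 1 \<longleftrightarrow> r u w = 1 \<and> r w v = 1 \<and> d u w + d w v = d u v"
proof -
  have "2 * \<delta> u v w \<le> r u w + r w v"
    and "(1 - \<delta> u v w) - (int n + 1) * (2 - r u w - r w v) \<le> d u w + d w v - d u v"
    and "d u w + d w v - d u v \<le> 2 * int n * (1 - \<delta> u v w)"
    using reach_bounds[of u v w] between_dist[of u v w] assms by auto
  moreover have "r u w = 0 \<or> r u w = 1" "r w v = 0 \<or> r w v = 1" "\<delta> u v w = 0 \<or> \<delta> u v w = 1"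
    using assms r_binary \<delta>_binary by auto
  ultimately show ?thesis by auto
qed

text \<open>
  The lower bound on \<open>\<Sum>w. \<delta> u v w\<close> exceeds the contribution 2 of the two ends exactly when
  \<open>r u v = 1\<close> but there is no arc from \<open>u\<close> to \<open>v\<close>. This is what rules out spurious
  solutions with \<open>r u v = 1\<close> for unconnected nodes.
\<close>

lemma between_exists:
  assumes uv: "u < n" "v < n" "u \<noteq> v" and r: "r u v = 1" and A: "A u v = 0"
  obtains w where "w < n" "u \<noteq> w" "v \<noteq> w" "\<delta> u v w = 1"
proof -
  have "2 + r u v - A u v \<le> (\<Sum>w<n. \<delta> u v w)"
    using between_count[OF uv] by simp
  then have "(\<Sum>w\<in>{..<n} - {u, v}. \<delta> u v w) \<noteq> 0"
    using \<delta>_ends[OF uv] r A by (simp add: sum_split_two[OF uv])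
  then obtain w where "w \<in> {..<n} - {u, v}" "\<delta> u v w \<noteq> 0"
    using sum.neutral by metis
  then show thesis
    using that[of w] \<delta>_binary[of u v w] uv by auto
qed

text \<open>
  The decreasing diagonal removes the freedom of choosing which indices are nodes: it makes
  the node set downward closed.
\<close>

lemma nodes_initial_segment:
  obtains m where "n\<^sub>0 \<le> m" "m \<le> n" "{v. v < n \<and> A v v = 1} = {..<m}"
proof -
  let ?V = "{v. v < n \<and> A v v = 1}"
  have closed: "u \<in> ?V" if "v \<in> ?V" "u \<le> v" for u v
    using that(2,1)
  proof (induction rule: inc_induct)
    case (step k)
    then have "k < n - 1" "A (Suc k) (Suc k) = 1" by auto
    moreover have "A k k \<ge> A (k + 1) (k + 1)"
      using node_decreasing[OF \<open>k < n - 1\<close>] .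
    ultimately show ?case using A_binary[of k k] by auto
  qed
  have fin: "finite ?V" by simp
  have "?V = {..<card ?V}"
  proof
    show sub: "?V \<subseteq> {..<card ?V}"
    proof
      fix v assume "v \<in> ?V"
      then have "{..v} \<subseteq> ?V" using closed by blast
      then have "card {..v} \<le> card ?V" using fin by (intro card_mono) auto
      then show "v \<in> {..<card ?V}" by simp
    qed
    show "{..<card ?V} \<subseteq> ?V"
      using card_subset_eq[OF _ sub] by simp
  qed
  moreover have "n\<^sub>0 \<le> card ?V"
  proof -
    have "(\<Sum>v<n. A v v) = (\<Sum>v<n. if A v v = 1 then 1 else 0)"
      using A_binary by (intro sum.cong) force+
    also have "\<dots> = int (card ?V)"
      by (simp add: sum.If_cases Collect_conj_eq lessThan_def)
    finally show ?thesis
      using node_count by simp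
  qed
  moreover have "card ?V \<le> n"
    using card_mono[of "{..<n}" ?V] by auto
  ultimately show thesis using that by blast
qed

end


section \<open>The graph determines the remaining variables\<close>

text \<open>
  A value \<open>r u v = 1\<close> comes either from an arc, which both families share, or from a node
  between \<open>u\<close> and \<open>v\<close> in the first family. In the latter case the induction applies to both
  halves, since distances between distinct nodes are positive, and transitivity and the
  triangle inequality of the second family join the results.
\<close>

lemma reach_dist_le:
  assumes F: "feasible_family n\<^sub>0 n A r d \<delta>" and F': "feasible_family n\<^sub>0' n A r' d' \<delta>'"
    and "u < n" "v < n" "r u v = 1"
  shows "r' u v = 1 \<and> d' u v \<le> d u v"
  using assms(3-)
proof (induction "nat (d u v)" arbitrary: u v rule: less_induct)
  case less
  interpret F: feasible_family n\<^sub>0 n A r d \<delta> by fact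
  interpret F': feasible_family n\<^sub>0' n A r' d' \<delta>' by fact
  note uv = \<open>u < n\<close> \<open>v < n\<close>
  consider "u = v" | "u \<noteq> v" "A u v = 1" | "u \<noteq> v" "A u v = 0"
    using F.A_binary[OF uv] by blast
  then show ?case
  proof cases
    case 1
    then show ?thesis using uv F.diagonal F'.diagonal by simp
  next
    case 2
    then show ?thesis using uv F.arc F'.arc by simp
  next
    case 3
    obtain w where w: "w < n" "u \<noteq> w" "v \<noteq> w" "\<delta> u v w = 1"
      using F.between_exists[OF uv 3(1) less.prems(3) 3(2)] .
    then have *: "r u w = 1" "r w v = 1" "d u w + d w v = d u v"
      using F.\<delta>_iff_between[OF uv w(1) 3(1) w(2,3)] by auto
    have "1 \<le> d u w" "1 \<le> d w v"
      using F.dist_pos uv w by auto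
    with * have "nat (d u w) < nat (d u v)" "nat (d w v) < nat (d u v)" by linarith+
    then have "r' u w = 1 \<and> d' u w \<le> d u w" "r' w v = 1 \<and> d' w v \<le> d w v"
      using less.hyps uv w(1) *(1,2) by auto
    then show ?thesis
      using F'.reach_trans[OF uv w(1)] *(3) by force
  qed
qed

lemma feasible_family_unique:
  assumes F: "feasible_family n\<^sub>0 n A r d \<delta>" and F': "feasible_family n\<^sub>0' n A r' d' \<delta>'"
  shows "r = r'" "d = d'" "\<delta> = \<delta>'"
proof -
  interpret F: feasible_family n\<^sub>0 n A r d \<delta> by fact
  interpret F': feasible_family n\<^sub>0' n A r' d' \<delta>' by fact
  have r: "r u v = r' u v" if "u < n" "v < n" for u v
    using that reach_dist_le[OF F F' that] reach_dist_le[OF F' F that]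
      F.r_binary[OF that] F'.r_binary[OF that] by auto
  have d: "d u v = d' u v" if "u < n" "v < n" for u v
  proof (cases "u = v \<or> r u v = 0")
    case True
    then show ?thesis
      using that r F.diagonal F'.diagonal F.dist_unreachable F'.dist_unreachable by metis
  next
    case False
    then show ?thesis
      using that r reach_dist_le[OF F F' that] reach_dist_le[OF F' F that]
        F.r_binary[OF that] by auto
  qed
  have \<delta>: "\<delta> u v w = \<delta>' u v w" if "u < n" "v < n" "w < n" for u v w
  proof (cases "u = v \<or> w = u \<or> w = v")
    case True
    then show ?thesis
      using that F.diagonal F'.diagonal F.\<delta>_ends F'.\<delta>_ends by metis
  next
    case False
    then have "\<delta> u v w = 1 \<longleftrightarrow> \<delta>' u v w = 1"
      using that r d F.\<delta>_iff_between F'.\<delta>_iff_between by simp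
    then show ?thesis
      using F.\<delta>_binary[OF that] F'.\<delta>_binary[OF that] by auto
  qed
  show "r = r'"
    using F.extensional(2) F'.extensional(2) by (rule PiE_PiE_ext) (use r in auto)
  show "d = d'"
    using F.extensional(3) F'.extensional(3) by (rule PiE_PiE_ext) (use d in auto)
  show "\<delta> = \<delta>'"
    using F.extensional(4) F'.extensional(4)
  proof (rule PiE_PiE_ext)
    fix u v assume uv: "u \<in> {..<n}" "v \<in> {..<n}"
    have "\<delta> u v \<in> {..<n} \<rightarrow>\<^sub>E {0, 1}" "\<delta>' u v \<in> {..<n} \<rightarrow>\<^sub>E {0, 1}"
      by (rule PiE_mem[OF PiE_mem[OF F.extensional(4) uv(1)] uv(2)],
          rule PiE_mem[OF PiE_mem[OF F'.extensional(4) uv(1)] uv(2)])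
    then show "\<delta> u v = \<delta>' u v"
      by (rule PiE_ext) (use \<delta> uv in auto)
  qed
qed


section \<open>Every graph has a feasible family\<close>

definition graph_of_adjacency :: "nat \<Rightarrow> (nat \<Rightarrow> nat \<Rightarrow> int) \<Rightarrow> nat pair_pre_digraph" where
  "graph_of_adjacency n A =
    \<lparr>pverts = {v. v < n \<and> A v v = 1},
     parcs = {(u, v). u < n \<and> v < n \<and> u \<noteq> v \<and> A u v = 1}\<rparr>"

text \<open>
  The family consists of reachability, shortest distances and membership in shortest walks.
  The ends \<open>u\<close> and \<open>v\<close> count as between even if \<open>v\<close> is unreachable from \<open>u\<close>, as the constraints
  prescribe; indices \<open>\<ge> m\<close> are isolated and have distance \<open>n\<close> to and from every other index.
\<close>

lemma feasible_family_exists: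
  assumes "n\<^sub>0 \<le> m" "m \<le> n" and E: "E \<subseteq> {..<m} \<times> {..<m}" and loopfree: "\<And>v. (v, v) \<notin> E"
  obtains A r d \<delta> where "feasible_family n\<^sub>0 n A r d \<delta>"
    "graph_of_adjacency n A = \<lparr>pverts = {..<m}, parcs = E\<rparr>"
proof -
  define A where "A = (\<lambda>u\<in>{..<n}. \<lambda>v\<in>{..<n}. of_bool (if u = v then u < m else (u, v) \<in> E) :: int)"
  define r where "r = (\<lambda>u\<in>{..<n}. \<lambda>v\<in>{..<n}. of_bool ((u, v) \<in> E\<^sup>*) :: int)"
  define d where "d = (\<lambda>u\<in>{..<n}. \<lambda>v\<in>{..<n}.
    if (u, v) \<in> E\<^sup>* then int (rel_dist E u v) else int n)"
  define \<delta> where "\<delta> = (\<lambda>u\<in>{..<n}. \<lambda>v\<in>{..<n}. \<lambda>w\<in>{..<n}.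
    of_bool (if u = v then w = v
             else w = u \<or> w = v \<or> (u, w) \<in> E\<^sup>* \<and> (w, v) \<in> E\<^sup>* \<and>
                  rel_dist E u w + rel_dist E w v = rel_dist E u v) :: int)"
  have reach: "u < m" "v < m" "1 \<le> rel_dist E u v" "rel_dist E u v < n"
    if "(u, v) \<in> E\<^sup>*" "u \<noteq> v" for u v
  proof -
    show "u < m" using that(1)
      by (cases rule: converse_rtranclE) (use that(2) E in auto)
    show "v < m" using that(1)
      by (cases rule: rtranclE) (use that(2) E in auto)
    show "1 \<le> rel_dist E u v"
      using that rel_dist_eq_0[of u v E] by fastforce
    show "rel_dist E u v < n"
      using rel_dist_less_card[of "{..<m}" E u v] E that \<open>u < m\<close> \<open>m \<le> n\<close> by simp
  qed
  have dist_le: "rel_dist E u v \<le> n" if "(u, v) \<in> E\<^sup>*" for u v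
    using reach(4)[OF that] rel_dist_refl[of E u] by (cases "u = v") auto
  \<comment> \<open>the facts \<open>c1\<close> to \<open>c10\<close> are literally the conjuncts of \<open>constraints\<close>\<close>
  have c1: "(\<Sum>v<n. A v v) \<ge> int n\<^sub>0"
  proof -
    have "(\<Sum>v<n. A v v) = (\<Sum>v<n. if v \<in> {..<m} then 1 else 0)"
      by (intro sum.cong) (auto simp: A_def)
    also have "\<dots> = int (card ({..<n} \<inter> {..<m}))"
      by (subst sum.If_cases) (simp_all only: Collect_mem_eq, simp_all)
    also have "{..<n} \<inter> {..<m} = {..<m}" using \<open>m \<le> n\<close> by auto
    finally show ?thesis using \<open>n\<^sub>0 \<le> m\<close> by simp
  qed
  have c2: "\<forall>v<n - 1. A v v \<ge> A (v + 1) (v + 1)"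
    by (auto simp: A_def)
  have c3: "\<forall>u<n. \<forall>v<n. u \<noteq> v \<longrightarrow>
       2 * r u v \<le> A u u + A v v \<and>
       d u v \<ge> int n * (1 - A u u) \<and>
       d u v \<ge> int n * (1 - A v v)"
    using reach(1,2) by (auto simp: A_def r_def d_def)
  have c4: "\<forall>v<n. r v v = 1 \<and> d v v = 0 \<and> \<delta> v v v = 1"
    by (simp add: r_def d_def \<delta>_def rel_dist_refl)
  have c5: "\<forall>v<n. \<forall>w<n. w \<noteq> v \<longrightarrow> \<delta> v v w = 0"
    by (simp add: \<delta>_def)
  have c6: "\<forall>u<n. \<forall>v<n. u \<noteq> v \<longrightarrow>
       r u v \<ge> A u v \<and>
       2 - A u v \<le> d u v \<and>
       d u v \<le> 1 + (int n - 1) * (1 - A u v)"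
  proof (intro allI impI)
    fix u v assume uv: "u < n" "v < n" "u \<noteq> v"
    show "r u v \<ge> A u v \<and> 2 - A u v \<le> d u v \<and> d u v \<le> 1 + (int n - 1) * (1 - A u v)"
    proof (cases "(u, v) \<in> E")
      case True
      then show ?thesis
        using uv rel_dist_arc[OF True] by (simp add: A_def r_def d_def r_into_rtrancl)
    next
      case False
      then show ?thesis
        using uv rel_dist_non_arc[of u v E] dist_le[of u v] by (auto simp: A_def r_def d_def)
    qed
  qed
  have c7: "\<forall>u<n. \<forall>v<n. u \<noteq> v \<longrightarrow>
       r u v \<le> int n - d u v \<and>
       int n - d u v \<le> (int n - 1) * r u v"
    using reach(3,4) by (force simp: r_def d_def)
  have c8: "\<forall>u<n. \<forall>v<n. \<forall>w<n. u \<noteq> v \<and> u \<noteq> w \<and> v \<noteq> w \<longrightarrow>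
       2 * \<delta> u v w \<le> r u w + r w v \<and>
       r u w + r w v \<le> 1 + r u v"
    by (auto simp: r_def \<delta>_def intro: rtrancl_trans)
  have c9: "\<forall>u<n. \<forall>v<n. u \<noteq> v \<longrightarrow>
       \<delta> u v u = 1 \<and> \<delta> u v v = 1 \<and>
       2 + r u v - A u v \<le> (\<Sum>w<n. \<delta> u v w) \<and>
       (\<Sum>w<n. \<delta> u v w) \<le> 2 + (int n - 2) * (r u v - A u v)"
  proof (intro allI impI)
    fix u v assume uv: "u < n" "v < n" "u \<noteq> v"
    let ?I = "{..<n} - {u, v}"
    have ends: "\<delta> u v u = 1" "\<delta> u v v = 1"
      using uv by (auto simp: \<delta>_def)
    have split: "(\<Sum>w<n. \<delta> u v w) = 2 + (\<Sum>w\<in>?I. \<delta> u v w)"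
      by (simp add: sum_split_two[OF uv] ends)
    consider "(u, v) \<notin> E\<^sup>*" | "(u, v) \<in> E" | "(u, v) \<in> E\<^sup>*" "(u, v) \<notin> E" by blast
    then have "r u v - A u v \<le> (\<Sum>w\<in>?I. \<delta> u v w) \<and>
      (\<Sum>w\<in>?I. \<delta> u v w) \<le> (int n - 2) * (r u v - A u v)"
    proof cases
      case 1
      then have "(u, v) \<notin> E" by blast
      moreover have "(\<Sum>w\<in>?I. \<delta> u v w) = 0"
        using 1 uv by (intro sum.neutral) (auto simp: \<delta>_def dest: rtrancl_trans)
      ultimately show ?thesis using 1 uv by (simp add: r_def A_def)
    next
      case 2
      \<comment> \<open>an interior node would split the distance 1 into two positive distances\<close>
      have "\<delta> u v w = 0" if "w \<in> ?I" for w
        using that uv reach(3)[of u w] reach(3)[of w v] rel_dist_arc[OF 2 uv(3)]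
        by (auto simp: \<delta>_def)
      then have "(\<Sum>w\<in>?I. \<delta> u v w) = 0" by simp
      then show ?thesis using 2 uv by (simp add: r_def A_def r_into_rtrancl)
    next
      case 3
      \<comment> \<open>the last node before \<open>v\<close> on a shortest walk is interior\<close>
      have "2 \<le> rel_dist E u v"
        using rel_dist_non_arc[OF 3 uv(3)] .
      then obtain k where k: "rel_dist E u v = Suc k" "1 \<le> k"
        by (cases "rel_dist E u v") auto
      obtain w where w: "(u, w) \<in> E\<^sup>*" "(w, v) \<in> E" "rel_dist E u w = k"
        using rel_dist_penultimate[OF 3(1) k(1)] .
      have "w \<noteq> u" using w(3) k(2) rel_dist_refl[of E u] by auto
      moreover have "w \<noteq> v" using w(2) loopfree by auto
      moreover have "w < n" using w(2) E \<open>m \<le> n\<close> by auto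
      ultimately have wI: "w \<in> ?I" by simp
      have "rel_dist E w v = 1"
        using rel_dist_arc[OF w(2) \<open>w \<noteq> v\<close>] .
      then have "\<delta> u v w = 1"
        using w k uv \<open>w < n\<close> by (auto simp: \<delta>_def)
      moreover have "\<delta> u v w \<le> (\<Sum>w\<in>?I. \<delta> u v w)"
        using wI uv by (intro member_le_sum) (auto simp: \<delta>_def)
      ultimately have "1 \<le> (\<Sum>w\<in>?I. \<delta> u v w)" by simp
      moreover have "(\<Sum>w\<in>?I. \<delta> u v w) \<le> int (card ?I) * 1"
        using uv by (intro sum_bounded_above) (auto simp: \<delta>_def)
      moreover have "int (card ?I) = int n - 2"
        using uv by (simp add: card_Diff_subset)
      ultimately show ?thesis using 3 uv by (simp add: r_def A_def)
    qed
    then show "\<delta> u v u = 1 \<and> \<delta> u v v = 1 \<and>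
       2 + r u v - A u v \<le> (\<Sum>w<n. \<delta> u v w) \<and>
       (\<Sum>w<n. \<delta> u v w) \<le> 2 + (int n - 2) * (r u v - A u v)"
      using ends split by simp
  qed
  have c10: "\<forall>u<n. \<forall>v<n. \<forall>w<n. u \<noteq> v \<and> u \<noteq> w \<and> v \<noteq> w \<longrightarrow>
       (1 - \<delta> u v w) - (int n + 1) * (2 - r u w - r w v) \<le> d u w + d w v - d u v \<and>
       d u w + d w v - d u v \<le> 2 * int n * (1 - \<delta> u v w)"
  proof (intro allI impI)
    fix u v w assume uvw: "u < n" "v < n" "w < n" and ne: "u \<noteq> v \<and> u \<noteq> w \<and> v \<noteq> w"
    have d: "0 \<le> d u w" "d u w \<le> int n" "0 \<le> d w v" "d w v \<le> int n" "0 \<le> d u v" "d u v \<le> int n"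
      using uvw dist_le by (auto simp: d_def)
    show "(1 - \<delta> u v w) - (int n + 1) * (2 - r u w - r w v) \<le> d u w + d w v - d u v \<and>
       d u w + d w v - d u v \<le> 2 * int n * (1 - \<delta> u v w)"
    proof (cases "(u, w) \<in> E\<^sup>* \<and> (w, v) \<in> E\<^sup>*")
      case True
      then have "(u, v) \<in> E\<^sup>*" by auto
      with True show ?thesis
        using uvw ne d rel_dist_triangle[of u w E v] by (auto simp: r_def d_def \<delta>_def)
    next
      case False
      then have \<delta>0: "\<delta> u v w = 0" and "r u w + r w v \<le> 1"
        using uvw ne by (auto simp: r_def \<delta>_def)
      define M where "M = (int n + 1) * (2 - r u w - r w v)"
      have "(int n + 1) * 1 \<le> M"
        unfolding M_def using \<open>r u w + r w v \<le> 1\<close> by (intro mult_left_mono) auto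
      with d \<delta>0 show ?thesis
        unfolding M_def[symmetric] by simp
    qed
  qed
  have "constraints n\<^sub>0 n A r d \<delta>"
    unfolding constraints_def
    by (intro conjI; fact c1 c2 c3 c4 c5 c6 c7 c8 c9 c10)
  moreover have "A \<in> {..<n} \<rightarrow>\<^sub>E {..<n} \<rightarrow>\<^sub>E {0, 1}" "r \<in> {..<n} \<rightarrow>\<^sub>E {..<n} \<rightarrow>\<^sub>E {0, 1}"
    "\<delta> \<in> {..<n} \<rightarrow>\<^sub>E {..<n} \<rightarrow>\<^sub>E {..<n} \<rightarrow>\<^sub>E {0, 1}"
    by (auto simp: A_def r_def \<delta>_def restrict_def PiE_iff extensional_def)
  moreover have "d \<in> {..<n} \<rightarrow>\<^sub>E {..<n} \<rightarrow>\<^sub>E {0..int n}"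
    using dist_le by (auto simp: d_def restrict_def PiE_iff extensional_def)
  ultimately have "feasible_family n\<^sub>0 n A r d \<delta>"
    by unfold_locales (simp add: feasible_families_def)
  moreover have "graph_of_adjacency n A = \<lparr>pverts = {..<m}, parcs = E\<rparr>"
    using E \<open>m \<le> n\<close> loopfree by (auto simp: graph_of_adjacency_def A_def split: if_splits)
  ultimately show thesis by (rule that)
qed


section \<open>The bijection\<close>

lemma graph_of_adjacency_inject:
  assumes A: "A \<in> {..<n} \<rightarrow>\<^sub>E {..<n} \<rightarrow>\<^sub>E {0, 1}" and B: "B \<in> {..<n} \<rightarrow>\<^sub>E {..<n} \<rightarrow>\<^sub>E {0, 1}"
    and eq: "graph_of_adjacency n A = graph_of_adjacency n B"
  shows "A = B"
  using A B
proof (rule PiE_PiE_ext)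
  fix u v assume uv: "u \<in> {..<n}" "v \<in> {..<n}"
  have "A u v = 1 \<longleftrightarrow> B u v = 1"
    using eq uv by (cases "u = v") (auto simp: graph_of_adjacency_def set_eq_iff)
  moreover have "A u v \<in> {0, 1}" "B u v \<in> {0, 1}"
    using uv A B by (blast dest: PiE_mem)+
  ultimately show "A u v = B u v" by auto
qed

lemma (in feasible_family) graph_of_adjacency_labeled:
  "graph_of_adjacency n A \<in> labeled_digraphs n\<^sub>0 n"
proof -
  have "finite (parcs (graph_of_adjacency n A))"
    by (rule finite_subset[of _ "{..<n} \<times> {..<n}"]) (auto simp: graph_of_adjacency_def)
  then have "pair_digraph (graph_of_adjacency n A)"
    by unfold_locales (auto simp: graph_of_adjacency_def arc)
  with nodes_initial_segment show ?thesis
    unfolding labeled_digraphs_def by (auto simp: graph_of_adjacency_def)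
qed

theorem theorem1:
  fixes n\<^sub>0 n :: nat
  assumes "1 \<le> n\<^sub>0" and "n\<^sub>0 \<le> n"
  shows "\<exists>f. bij_betw f (feasible_families n\<^sub>0 n) (labeled_digraphs n\<^sub>0 n)"
proof
  let ?f = "\<lambda>(A, r, d, \<delta>). graph_of_adjacency n A"
  show "bij_betw ?f (feasible_families n\<^sub>0 n) (labeled_digraphs n\<^sub>0 n)"
  proof (rule bij_betwI')
    fix X Y assume X: "X \<in> feasible_families n\<^sub>0 n" and Y: "Y \<in> feasible_families n\<^sub>0 n"
    obtain A r d \<delta> A' r' d' \<delta>' where XY: "X = (A, r, d, \<delta>)" "Y = (A', r', d', \<delta>')"
      by (cases X, cases Y)
    have F: "feasible_family n\<^sub>0 n A r d \<delta>" and F': "feasible_family n\<^sub>0 n A' r' d' \<delta>'"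
      using X Y XY by (simp_all add: feasible_family_def)
    show "?f X = ?f Y \<longleftrightarrow> X = Y"
    proof
      assume "?f X = ?f Y"
      then have "A = A'"
        using graph_of_adjacency_inject[OF feasible_family.extensional(1)[OF F]
            feasible_family.extensional(1)[OF F']] XY by simp
      then show "X = Y"
        using feasible_family_unique[of n\<^sub>0 n A r d \<delta> n\<^sub>0 r' d' \<delta>'] F F' XY by simp
    qed simp
  next
    fix X assume "X \<in> feasible_families n\<^sub>0 n"
    then show "?f X \<in> labeled_digraphs n\<^sub>0 n"
      by (cases X)
        (auto intro: feasible_family.graph_of_adjacency_labeled simp: feasible_family_def)
  next
    fix G assume "G \<in> labeled_digraphs n\<^sub>0 n"
    then obtain m where G: "pair_digraph G" and m: "n\<^sub>0 \<le> m" "m \<le> n" "pverts G = {..<m}"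
      by (auto simp: labeled_digraphs_def)
    interpret pair_digraph G by fact
    have "parcs G \<subseteq> {..<m} \<times> {..<m}"
      using m(3) in_arcsD1 in_arcsD2 by auto
    moreover have "(v, v) \<notin> parcs G" for v
      using pair_no_loops by force
    ultimately obtain A r d \<delta> where "feasible_family n\<^sub>0 n A r d \<delta>"
      "graph_of_adjacency n A = \<lparr>pverts = {..<m}, parcs = parcs G\<rparr>"
      using feasible_family_exists m(1,2) by blast
    then have "(A, r, d, \<delta>) \<in> feasible_families n\<^sub>0 n" "G = ?f (A, r, d, \<delta>)"
      using m(3) by (simp_all add: feasible_family_def)
    then show "\<exists>X\<in>feasible_families n\<^sub>0 n. G = ?f X" by blast
  qed
qed

end
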